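(* Let $F$ be the simplicial complex on vertex set $\{v_1,\dots,v_6\}$ whose edge set is the downward closure of $\{v_1v_2v_3,\ v_4v_5v_6,\ v_1v_4\}$. There is $C\in\mathbb N$ such that for every positive integer $n$, $$n^2-n+2\le \mathrm{ex}(n,F)\le n^2-n+C.$$
   Context: A simplicial complex is a pair $H=(V,E)$ with $E\subseteq\mathscr P(V)$ closed under taking subsets; all sets in $E$ (including the empty set and singletons) count as edges. $H$ contains a copy of $F$ if there is an injection $\varphi:V(F)\to V(H)$ with $\varphi(e)\in E(H)$ for every $e\in E(F)$. $\mathrm{ex}(n,F)$ is the maximum number of edges of a simplicial complex on $n$ vertices containing no copy of $F$. *)

theory Defs
  imports Main
begin

type_synonym 'a cplx = "'a set \<times> 'a set set"

definition vertices :: "'a cplx \<Rightarrow> 'a set" where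
  "vertices H = fst H"

definition edges :: "'a cplx \<Rightarrow> 'a set set" where
  "edges H = snd H"

definition simplicial_complex :: "'a cplx \<Rightarrow> bool" where
  "simplicial_complex H \<longleftrightarrow>
     edges H \<subseteq> Pow (vertices H) \<and> (\<forall>e\<in>edges H. \<forall>f. f \<subseteq> e \<longrightarrow> f \<in> edges H)"

definition contains_copy :: "'a cplx \<Rightarrow> 'b cplx \<Rightarrow> bool" where
  "contains_copy H F \<longleftrightarrow>
     (\<exists>\<phi>. \<phi> ` vertices F \<subseteq> vertices H \<and> inj_on \<phi> (vertices F) \<and>
          (\<forall>e\<in>edges F. \<phi> ` e \<in> edges H))"

text \<open>The host complexes range over all finite vertex sets of natural numbers; every complex on
  \<open>n\<close> vertices is isomorphic to one of these. The set below is finite, as a complex on \<open>n\<close>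
  vertices has at most \<open>2 ^ n\<close> edges. It is empty only if every complex on \<open>n\<close> vertices
  contains \<open>F\<close>; this does not happen if \<open>F\<close> has an edge, since the complex without edges is allowed.\<close>

definition ex_num :: "nat \<Rightarrow> 'b cplx \<Rightarrow> nat" where
  "ex_num n F =
     Max {card (edges H) | H :: nat cplx.
            simplicial_complex H \<and> finite (vertices H) \<and> card (vertices H) = n \<and>
            \<not> contains_copy H F}"

definition down_closure :: "'a set set \<Rightarrow> 'a set set" where
  "down_closure A = {e. \<exists>f\<in>A. e \<subseteq> f}"

definition F_cplx :: "nat cplx" where
  "F_cplx = ({1..6}, down_closure {{1, 2, 3}, {4, 5, 6}, {1, 4}})"

end

theory Submission
  imports Defs
begin

text \<open>
  The lower bound is attained by the complex of all sets with at most two elements besides a fixed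
  vertex: any two of its triples meet.

  For the upper bound, delete a vertex of degree at most \<open>2n - 2\<close> and induct, absorbing small \<open>n\<close>
  into the constant. Such a vertex exists once \<open>n \<ge> 26\<close>. Suppose all degrees are larger. If every
  triple avoiding \<open>v\<close> were disjoint from some triple through \<open>v\<close>, then every triple through a
  neighbour \<open>u\<close> of \<open>v\<close> would contain \<open>v\<close>, and \<open>u\<close> would have degree at most \<open>2n - 2\<close>. So a single
  triple meets all triples through \<open>v\<close>, and by pigeonhole \<open>v\<close> lies in a heavy pair, that is, a
  pair contained in at least four triples. Disjoint heavy pairs are not joined by an edge, and no
  vertex lies in four heavy pairs. But if \<open>uv\<close> is heavy, each of its at least four common
  neighbours in triples \<open>uvw\<close> forms a heavy pair with \<open>u\<close> or with \<open>v\<close>, and both occur, so there are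
  disjoint heavy pairs joined by the edge \<open>uv\<close>.
\<close>

section \<open>Disjoint triples joined by an edge, and heavy pairs\<close>

text \<open>For a complex this is the absence of \<open>F_cplx\<close>: \<open>e\<close> and
  \<open>f\<close> play its two triples, \<open>{a, b}\<close> the edge between them. It passes to
  subfamilies, as vertex deletion requires.\<close>

definition joined_triple_free :: "'a set set \<Rightarrow> bool" where
  "joined_triple_free E \<longleftrightarrow>
     (\<forall>e\<in>E. \<forall>f\<in>E. card e = 3 \<longrightarrow> card f = 3 \<longrightarrow> e \<inter> f = {} \<longrightarrow> (\<forall>a\<in>e. \<forall>b\<in>f. {a, b} \<notin> E))"

definition pair_link :: "'a set set \<Rightarrow> 'a \<Rightarrow> 'a \<Rightarrow> 'a set" where
  "pair_link E u v = {w. w \<noteq> u \<and> w \<noteq> v \<and> {u, v, w} \<in> E}"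

text \<open>Four is the least threshold at which a heavy pair always extends to a triple avoiding
  three prescribed vertices, such as those of a disjoint triple.\<close>

definition heavy :: "'a set set \<Rightarrow> 'a \<Rightarrow> 'a \<Rightarrow> bool" where
  "heavy E u v \<longleftrightarrow> u \<noteq> v \<and> 4 \<le> card (pair_link E u v)"

lemma card_three_with_member:
  assumes "card e = 3" "a \<in> e"
  obtains p q where "e = {a, p, q}" "a \<noteq> p" "a \<noteq> q" "p \<noteq> q"
proof -
  have "card (e - {a}) = 2"
    using assms by simp
  then obtain p q where pq: "e - {a} = {p, q}" "p \<noteq> q"
    by (meson card_2_iff)
  then have "e = {a, p, q}"
    using assms(2) by blast
  with pq that show ?thesis
    by blast
qed

lemma heavy_commute: "heavy E u v \<longleftrightarrow> heavy E v u"
proof -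
  have "pair_link E u v = pair_link E v u"
    by (auto simp: pair_link_def insert_commute)
  then show ?thesis
    by (auto simp: heavy_def)
qed

lemma heavy_extend:
  assumes "heavy E u v" "card A \<le> 3" "finite A"
  obtains w where "w \<notin> A" "w \<noteq> u" "w \<noteq> v" "u \<noteq> v" "{u, v, w} \<in> E"
proof -
  have "\<not> pair_link E u v \<subseteq> A"
    using assms card_mono[of A "pair_link E u v"] by (auto simp: heavy_def)
  with assms(1) that show ?thesis
    by (auto simp: pair_link_def heavy_def)
qed

section \<open>Complexes with all degrees large\<close>

locale dense_complex =
  fixes V :: "'a set" and E :: "'a set set"
  assumes fin: "finite V"
    and sub: "E \<subseteq> Pow V"
    and down: "\<And>e f. e \<in> E \<Longrightarrow> f \<subseteq> e \<Longrightarrow> f \<in> E"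
    and free: "joined_triple_free E"
    and large: "26 \<le> card V"
    and degree: "\<And>v. v \<in> V \<Longrightarrow> 2 * card V - 1 \<le> card {e \<in> E. v \<in> e}"
begin

lemma finite_face: "e \<in> E \<Longrightarrow> finite e"
  using fin sub finite_subset by blast

lemma finite_pair_link: "finite (pair_link E u v)"
proof -
  have "pair_link E u v \<subseteq> V"
    using sub by (auto simp: pair_link_def)
  then show ?thesis
    using fin finite_subset by blast
qed

lemma freeD:
  assumes "e \<in> E" "f \<in> E" "card e = 3" "card f = 3" "e \<inter> f = {}" "a \<in> e" "b \<in> f" "{a, b} \<in> E"
  shows False
  using free assms unfolding joined_triple_free_def by blast

text \<open>Two vertices outside \<open>{u, v}\<close> in an edge at \<open>u\<close> would form
  with \<open>u\<close> a triple without \<open>v\<close>. So there is at most one, which leaves at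
  most \<open>card V\<close> edges in \<open>?A\<close> (\<open>x = u\<close> gives
  \<open>{u}\<close>) and \<open>card V - 2\<close> in \<open>?B\<close>.\<close>

lemma degree_le_if_triples_contain:
  assumes uv: "u \<noteq> v" "u \<in> V" "v \<in> V"
    and all: "\<And>e. e \<in> E \<Longrightarrow> card e = 3 \<Longrightarrow> u \<in> e \<Longrightarrow> v \<in> e"
  shows "card {e \<in> E. u \<in> e} \<le> 2 * card V - 2"
proof -
  let ?A = "(\<lambda>x. {u, x}) ` V" and ?B = "(\<lambda>x. {u, v, x}) ` (V - {u, v})"
  have "{e \<in> E. u \<in> e} \<subseteq> ?A \<union> ?B"
  proof clarify
    fix e assume e: "e \<in> E" "u \<in> e" "e \<notin> ?B"
    have eV: "e \<subseteq> V" using e sub by blast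
    have one: "x = y" if "x \<in> e - {u, v}" "y \<in> e - {u, v}" for x y
    proof (rule ccontr)
      assume "x \<noteq> y"
      then have "card {u, x, y} = 3" using that by auto
      moreover have "{u, x, y} \<in> E" using that e down[of e] by auto
      ultimately have "v \<in> {u, x, y}" using all by blast
      then show False using that uv by auto
    qed
    show "e \<in> ?A"
    proof (cases "e - {u, v} = {}")
      case True
      then have "e = {u, u} \<or> e = {u, v}" using e by auto
      then show ?thesis using uv by blast
    next
      case False
      then obtain x where x: "e - {u, v} = {x}" using one by blast
      then have "e = {u, x} \<or> e = {u, v, x}" using e by auto
      then show ?thesis using x e eV by blast
    qed
  qed
  then have "card {e \<in> E. u \<in> e} \<le> card (?A \<union> ?B)"
    using fin by (intro card_mono) auto
  also have "\<dots> \<le> card ?A + card ?B"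
    by (rule card_Un_le)
  also have "\<dots> \<le> card V + card (V - {u, v})"
    using fin by (intro add_mono card_image_le) auto
  also have "card (V - {u, v}) = card V - 2"
    using uv fin by (subst card_Diff_subset) auto
  finally show ?thesis
    using large by linarith
qed

lemma hitting_triple:
  assumes v: "v \<in> V"
  obtains t where "t \<in> E" "card t = 3" "v \<notin> t"
    "\<And>f. f \<in> E \<Longrightarrow> card f = 3 \<Longrightarrow> v \<in> f \<Longrightarrow> f \<inter> t \<noteq> {}"
proof (rule ccontr)
  note found = that
  assume "\<not> thesis"
  then have esc: "\<exists>f\<in>E. card f = 3 \<and> v \<in> f \<and> f \<inter> t = {}"
    if t: "t \<in> E" "card t = 3" "v \<notin> t" for t
    using found[OF t] by blast
  have "\<not> {e \<in> E. v \<in> e} \<subseteq> {{v}}"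
    using degree[OF v] large card_mono[of "{{v}}" "{e \<in> E. v \<in> e}"] by auto
  then obtain e where e: "e \<in> E" "v \<in> e" "e \<noteq> {v}" by auto
  then obtain u where u: "u \<in> e" "u \<noteq> v" by blast
  have uv: "{u, v} \<in> E" "u \<in> V"
    using e u sub down[of e "{u, v}"] by auto
  \<comment> \<open>Otherwise some triple \<open>f\<close> at \<open>v\<close> is disjoint from
    \<open>g\<close>, and \<open>{u, v}\<close> joins the two.\<close>
  have "v \<in> g" if g: "g \<in> E" "card g = 3" "u \<in> g" for g
  proof (rule ccontr)
    assume "v \<notin> g"
    then obtain f where "f \<in> E" "card f = 3" "v \<in> f" "f \<inter> g = {}"
      using esc g by blast
    then show False
      using freeD[of g f u v] g uv by blast
  qed
  then have "card {e \<in> E. u \<in> e} \<le> 2 * card V - 2"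
    using degree_le_if_triples_contain u uv v by blast
  then show False
    using degree[OF uv(2)] large by linarith
qed

text \<open>As \<open>t\<close> hits all triples at \<open>v\<close>, an edge at \<open>v\<close>
  with more than two vertices contains some \<open>a\<close> in \<open>t\<close>. If all links
  \<open>pair_link E v a\<close> had at most 3 elements, the degree would be at most
  \<open>card V + 3 * 2 ^ 3\<close>, which is below \<open>2 * card V - 1\<close> once
  \<open>card V\<close> is at least 26.\<close>

lemma ex_heavy:
  assumes v: "v \<in> V"
  obtains u where "heavy E v u"
proof (rule ccontr)
  assume "\<not> thesis"
  then have light: "\<not> heavy E v u" for u
    using that by blast
  obtain t where t: "t \<in> E" "card t = 3" "v \<notin> t"
    and hit: "\<And>f. f \<in> E \<Longrightarrow> card f = 3 \<Longrightarrow> v \<in> f \<Longrightarrow> f \<inter> t \<noteq> {}"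
    using hitting_triple[OF v] by blast
  let ?A = "(\<lambda>x. {v, x}) ` V"
  let ?B = "\<lambda>a. (\<lambda>s. insert v (insert a s)) ` Pow (pair_link E v a)"
  have ft: "finite t" using t finite_face by blast
  have fB: "finite (?B a)" for a using finite_pair_link by simp
  have cB: "card (?B a) \<le> 8" if "a \<in> t" for a
  proof -
    have "card (pair_link E v a) \<le> 3"
      using light[of a] that t by (auto simp: heavy_def)
    then have "(2::nat) ^ card (pair_link E v a) \<le> 2 ^ 3"
      by (intro power_increasing) auto
    moreover have "card (?B a) \<le> card (Pow (pair_link E v a))"
      using finite_pair_link by (intro card_image_le) auto
    ultimately show ?thesis
      using finite_pair_link by (simp add: card_Pow)
  qed
  have "{e \<in> E. v \<in> e} \<subseteq> ?A \<union> (\<Union>a\<in>t. ?B a)"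
  proof clarify
    fix e assume e: "e \<in> E" "v \<in> e" "e \<notin> (\<Union>a\<in>t. ?B a)"
    have eV: "e \<subseteq> V" using e sub by blast
    have no: "a \<notin> e" if "a \<in> t" for a
    proof
      assume a: "a \<in> e"
      \<comment> \<open>Edges of every size are covered: each vertex of \<open>e - {v, a}\<close>
        forms a triple with \<open>v\<close> and \<open>a\<close> by downward closure.\<close>
      have "e - {v, a} \<subseteq> pair_link E v a"
        using e a down[of e] by (auto simp: pair_link_def)
      moreover have "e = insert v (insert a (e - {v, a}))"
        using e a by auto
      ultimately have "e \<in> ?B a" by blast
      then show False using e that by blast
    qed
    have one: "x = y" if "x \<in> e - {v}" "y \<in> e - {v}" for x y
    proof (rule ccontr)
      assume "x \<noteq> y"
      then have "card {v, x, y} = 3" using that by auto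
      moreover have "{v, x, y} \<in> E" using that e down[of e] by auto
      ultimately have "{v, x, y} \<inter> t \<noteq> {}" using hit by blast
      then show False using no that e by auto
    qed
    show "e \<in> ?A"
    proof (cases "e - {v} = {}")
      case True
      then have "e = {v, v}" using e by auto
      then show ?thesis using v by blast
    next
      case False
      then obtain x where "e - {v} = {x}" using one by blast
      then have "e = {v, x}" using e by auto
      then show ?thesis using eV by blast
    qed
  qed
  then have "card {e \<in> E. v \<in> e} \<le> card (?A \<union> (\<Union>a\<in>t. ?B a))"
    using fin fB ft by (intro card_mono) auto
  also have "\<dots> \<le> card ?A + card (\<Union>a\<in>t. ?B a)"
    by (rule card_Un_le)
  also have "\<dots> \<le> card V + (\<Sum>a\<in>t. card (?B a))"
    using fin ft by (intro add_mono card_image_le card_UN_le) auto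
  also have "(\<Sum>a\<in>t. card (?B a)) \<le> (\<Sum>a\<in>t. 8)"
    using cB by (rule sum_mono)
  finally have "card {e \<in> E. v \<in> e} \<le> card V + 24"
    using t by simp
  then show False
    using degree[OF v] large by linarith
qed

text \<open>Extend \<open>{x, y}\<close> by \<open>p\<close> off the other pair, then
  \<open>{z, w}\<close> by \<open>q\<close> off \<open>{x, y, p}\<close>. The resulting triples are
  disjoint, so \<open>{x, z}\<close> cannot join them.\<close>

lemma disjoint_heavy_not_joined:
  assumes "heavy E x y" "heavy E z w" "{x, y} \<inter> {z, w} = {}"
  shows "{x, z} \<notin> E"
proof
  assume xz: "{x, z} \<in> E"
  obtain p where p: "p \<notin> {z, w}" "p \<noteq> x" "p \<noteq> y" "x \<noteq> y" "{x, y, p} \<in> E"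
    using heavy_extend[OF assms(1), of "{z, w}"] card_insert_le_m1[of 3 "{w}" z] by auto
  obtain q where q: "q \<notin> {x, y, p}" "q \<noteq> z" "q \<noteq> w" "z \<noteq> w" "{z, w, q} \<in> E"
    using heavy_extend[OF assms(2), of "{x, y, p}"] p by auto
  show False
    using p q assms(3) xz by (intro freeD[of "{x, y, p}" "{z, w, q}" x z]) auto
qed

text \<open>A triple \<open>t\<close> that hits all triples at \<open>u\<close> misses some
  \<open>x\<close> in \<open>W\<close>, yet \<open>{u, x}\<close> extends by a vertex off
  \<open>t\<close> to a triple missing \<open>t\<close>.\<close>

lemma not_four_heavy:
  assumes u: "u \<in> V" and W: "\<And>w. w \<in> W \<Longrightarrow> heavy E u w" and card: "4 \<le> card W"
  shows False
proof -
  obtain t where t: "t \<in> E" "card t = 3" "u \<notin> t"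
    and hit: "\<And>f. f \<in> E \<Longrightarrow> card f = 3 \<Longrightarrow> u \<in> f \<Longrightarrow> f \<inter> t \<noteq> {}"
    using hitting_triple[OF u] by blast
  have ft: "finite t" using t finite_face by blast
  have "\<not> W \<subseteq> t"
    using card t ft card_mono[of t W] by auto
  then obtain x where x: "x \<in> W" "x \<notin> t" by blast
  obtain y where y: "y \<notin> t" "y \<noteq> u" "y \<noteq> x" "u \<noteq> x" "{u, x, y} \<in> E"
    using heavy_extend[OF W[OF x(1)], of t] t ft by auto
  then have "{u, x, y} \<inter> t \<noteq> {}"
    by (intro hit) auto
  then show False
    using x y t by auto
qed

lemma inconsistent: False
proof -
  obtain v where v: "v \<in> V" using large by fastforce
  obtain u where vu: "heavy E v u" using ex_heavy[OF v] by blast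
  let ?W = "pair_link E v u"
  have W: "4 \<le> card ?W" "v \<noteq> u" using vu by (auto simp: heavy_def)
  then have "?W \<noteq> {}" by auto
  then obtain w where "{v, u, w} \<in> E" by (auto simp: pair_link_def)
  then have E_vu: "{v, u} \<in> E" "u \<in> V" using down[of "{v, u, w}"] sub by auto
  \<comment> \<open>The vertex \<open>w\<close> lies in a heavy pair of its own, which must meet
    \<open>{v, u}\<close> because \<open>w\<close> is adjacent to \<open>v\<close>.\<close>
  have choice: "heavy E v w \<or> heavy E u w" if w: "w \<in> ?W" for w
  proof -
    have wE: "{v, u, w} \<in> E" "w \<noteq> v" "w \<noteq> u" using w by (auto simp: pair_link_def)
    then have "w \<in> V" "{w, v} \<in> E" using sub down[of "{v, u, w}" "{w, v}"] by auto
    obtain y where wy: "heavy E w y" using ex_heavy[OF \<open>w \<in> V\<close>] by blast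
    then have "{w, y} \<inter> {v, u} \<noteq> {}"
      using disjoint_heavy_not_joined[OF wy vu] \<open>{w, v} \<in> E\<close> by blast
    then have "y = v \<or> y = u" using wE by auto
    then show ?thesis using wy heavy_commute by metis
  qed
  obtain w1 where w1: "w1 \<in> ?W" "\<not> heavy E u w1"
    using not_four_heavy[OF E_vu(2) _ W(1)] by blast
  obtain w2 where w2: "w2 \<in> ?W" "\<not> heavy E v w2"
    using not_four_heavy[OF v _ W(1)] by blast
  have h: "heavy E v w1" "heavy E u w2" using choice w1 w2 by blast+
  \<comment> \<open>\<open>w1\<close> and \<open>w2\<close> differ, since only the first is heavy
    with \<open>v\<close>.\<close>
  then have "{v, w1} \<inter> {u, w2} = {}"
    using w1 w2 W(2) by (auto simp: pair_link_def)
  then show False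
    using disjoint_heavy_not_joined[OF h] E_vu by blast
qed

end

section \<open>Upper bound by deleting vertices\<close>

lemma low_degree_vertex:
  assumes "finite V" "E \<subseteq> Pow V" "\<And>e f. e \<in> E \<Longrightarrow> f \<subseteq> e \<Longrightarrow> f \<in> E" "joined_triple_free E"
    and "26 \<le> card V"
  obtains v where "v \<in> V" "card {e \<in> E. v \<in> e} \<le> 2 * card V - 2"
proof (rule ccontr)
  note found = that
  assume "\<not> thesis"
  then have "\<not> card {e \<in> E. v \<in> e} \<le> 2 * card V - 2" if v: "v \<in> V" for v
    using found[OF v] by blast
  then have "2 * card V - 1 \<le> card {e \<in> E. v \<in> e}" if "v \<in> V" for v
    using that by fastforce
  then have "dense_complex V E"
    using assms by unfold_locales auto
  then show False
    by (rule dense_complex.inconsistent)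
qed

text \<open>The degree bound 2n - 2 is exactly the drop of n^2 - n from n to n - 1. The constant
  \<open>2 ^ 25\<close> counts all subsets of 25 vertices, the largest case not reached by the
  induction step.\<close>

lemma card_joined_triple_free_le:
  assumes "finite V" "E \<subseteq> Pow V" "\<And>e f. e \<in> E \<Longrightarrow> f \<subseteq> e \<Longrightarrow> f \<in> E" "joined_triple_free E"
  shows "int (card E) \<le> (int (card V))\<^sup>2 - int (card V) + 2 ^ 25"
  using assms
proof (induction "card V" arbitrary: V E rule: less_induct)
  case less
  have finE: "finite E" using less.prems finite_subset[of E "Pow V"] by simp
  show ?case
  proof (cases "card V < 26")
    case True
    have "card E \<le> card (Pow V)"
      using less.prems by (intro card_mono) auto
    also have "\<dots> = 2 ^ card V"
      using less.prems by (simp add: card_Pow)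
    also have "\<dots> \<le> 2 ^ 25"
      using True by (intro power_increasing) auto
    finally have "int (card E) \<le> 2 ^ 25" by simp
    moreover have "int (card V) \<le> (int (card V))\<^sup>2"
      by (cases "card V") (auto simp: power2_eq_square)
    ultimately show ?thesis by linarith
  next
    case False
    then obtain v where v: "v \<in> V" "card {e \<in> E. v \<in> e} \<le> 2 * card V - 2"
      using low_degree_vertex[of V E] less.prems by force
    let ?E = "{e \<in> E. v \<notin> e}"
    have cV: "card (V - {v}) = card V - 1" using v less.prems by simp
    have "int (card ?E) \<le> (int (card (V - {v})))\<^sup>2 - int (card (V - {v})) + 2 ^ 25"
    proof (rule less.hyps)
      show "card (V - {v}) < card V" using cV False by simp
      show "joined_triple_free ?E"
        using less.prems(4) unfolding joined_triple_free_def by blast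
      show "f \<in> ?E" if "e \<in> ?E" "f \<subseteq> e" for e f
        using that less.prems(3)[of e f] by blast
    qed (use less.prems in auto)
    moreover have "card E = card ?E + card {e \<in> E. v \<in> e}"
      using finE by (subst card_Un_disjoint[symmetric]) (auto intro: arg_cong[where f = card])
    moreover have "int (card (V - {v})) = int (card V) - 1" using cV False by simp
    moreover have "int (card {e \<in> E. v \<in> e}) \<le> 2 * int (card V) - 2" using v False by linarith
    ultimately show ?thesis by (simp add: power2_eq_square algebra_simps)
  qed
qed

section \<open>Copies of the forbidden complex\<close>

lemma joined_triple_free_if_no_copy:
  assumes H: "simplicial_complex H" and no: "\<not> contains_copy H F_cplx"
  shows "joined_triple_free (edges H)"
  unfolding joined_triple_free_def
proof (intro ballI impI notI)
  fix e f a b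
  assume E: "e \<in> edges H" "f \<in> edges H" "card e = 3" "card f = 3" "e \<inter> f = {}" "a \<in> e" "b \<in> f"
    "{a, b} \<in> edges H"
  have down: "g \<in> edges H" if "e \<in> edges H" "g \<subseteq> e" for e g
    using H that unfolding simplicial_complex_def by blast
  obtain p q where e: "e = {a, p, q}" "a \<noteq> p" "a \<noteq> q" "p \<noteq> q"
    using card_three_with_member E by metis
  obtain r s where f: "f = {b, r, s}" "b \<noteq> r" "b \<noteq> s" "r \<noteq> s"
    using card_three_with_member E by metis
  \<comment> \<open>The default value \<open>s\<close> serves as the image of 6.\<close>
  define \<phi> :: "nat \<Rightarrow> _" where "\<phi> = (\<lambda>_. s)(1 := a, 2 := p, 3 := q, 4 := b, 5 := r)"
  have phi: "\<phi> 1 = a" "\<phi> 2 = p" "\<phi> 3 = q" "\<phi> 4 = b" "\<phi> 5 = r" "\<phi> 6 = s"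
    by (simp_all add: \<phi>_def)
  have V: "vertices F_cplx = {1, 2, 3, 4, 5, 6}"
    by (auto simp: vertices_def F_cplx_def)
  have "e \<subseteq> vertices H" "f \<subseteq> vertices H"
    using H E unfolding simplicial_complex_def by blast+
  then have "\<phi> ` vertices F_cplx \<subseteq> vertices H"
    by (simp add: V phi e f del: One_nat_def)
  moreover have "inj_on \<phi> (vertices F_cplx)"
    using e f E(5) by (auto simp: V phi simp del: One_nat_def)
  moreover have "\<phi> ` g \<in> edges H" if g: "g \<in> edges F_cplx" for g
  proof -
    obtain t where t: "t \<in> {{1, 2, 3}, {4, 5, 6}, {1, 4}}" "g \<subseteq> t"
      using g by (auto simp: edges_def F_cplx_def down_closure_def simp del: One_nat_def)
    have "\<phi> ` t \<in> {e, f, {a, b}}"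
      using t(1) phi e(1) f(1) by auto
    then have "\<phi> ` t \<in> edges H" using E(1,2,8) by (metis insertE singletonD)
    then show ?thesis using t(2) by (rule down[OF _ image_mono])
  qed
  ultimately have "contains_copy H F_cplx"
    unfolding contains_copy_def by (intro exI[of _ \<phi>]) simp
  then show False using no by blast
qed

section \<open>Lower bound: the star complex\<close>

definition star_complex :: "nat \<Rightarrow> nat cplx" where
  "star_complex n = ({..<n}, {e. e \<subseteq> {..<n} \<and> card (e - {0}) \<le> 2})"

lemma simplicial_complex_star: "simplicial_complex (star_complex n)"
  unfolding simplicial_complex_def
proof (intro conjI ballI allI impI)
  fix e f assume e: "e \<in> edges (star_complex n)" "f \<subseteq> e"
  then have "finite (e - {0})" "f - {0} \<subseteq> e - {0}"
    by (auto simp: star_complex_def edges_def intro: finite_subset)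
  then have "card (f - {0}) \<le> card (e - {0})" by (rule card_mono)
  then show "f \<in> edges (star_complex n)"
    using e by (auto simp: star_complex_def edges_def)
qed (auto simp: star_complex_def edges_def vertices_def)

text \<open>Both triples of a copy would contain 0, but an injection keeps them disjoint.\<close>

lemma star_no_copy: "\<not> contains_copy (star_complex n) F_cplx"
proof
  assume "contains_copy (star_complex n) F_cplx"
  then obtain \<phi> where inj: "inj_on \<phi> {1..6}"
    and edge: "\<And>e. e \<in> edges F_cplx \<Longrightarrow> \<phi> ` e \<in> edges (star_complex n)"
    unfolding contains_copy_def by (auto simp: vertices_def F_cplx_def)
  have zero: "0 \<in> \<phi> ` t" if "t \<in> edges F_cplx" "t \<subseteq> {1..6}" "card t = 3" for t
  proof (rule ccontr)
    assume "0 \<notin> \<phi> ` t"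
    then have "card (\<phi> ` t) \<le> 2"
      using edge[OF that(1)] by (simp add: star_complex_def edges_def)
    moreover have "card (\<phi> ` t) = 3"
      using that inj by (metis card_image inj_on_subset)
    ultimately show False by simp
  qed
  have "0 \<in> \<phi> ` {1, 2, 3}" "0 \<in> \<phi> ` {4, 5, 6}"
    by (intro zero; auto simp: edges_def F_cplx_def down_closure_def)+
  moreover have "\<phi> ` {1, 2, 3} \<inter> \<phi> ` {4, 5, 6} = {}"
    using inj by (subst inj_on_image_Int[symmetric]) auto
  ultimately show False by blast
qed

text \<open>Doubling clears the denominator of the binomial coefficient and is the form used in
  \<open>card_star\<close>.\<close>

lemma card_subsets_le_two:
  assumes "finite A"
  shows "2 * int (card {s. s \<subseteq> A \<and> card s \<le> 2}) = (int (card A))\<^sup>2 + int (card A) + 2"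
proof -
  let ?S = "\<lambda>k. {s. s \<subseteq> A \<and> card s = k}"
  have fin: "finite (?S k)" for k using assms by simp
  have "{s. s \<subseteq> A \<and> card s \<le> 2} = ?S 0 \<union> (?S 1 \<union> ?S 2)" by auto
  then have "card {s. s \<subseteq> A \<and> card s \<le> 2} = card (?S 0) + (card (?S 1) + card (?S 2))"
    using fin by (simp only:) (subst card_Un_disjoint; auto)+
  also have "\<dots> = 1 + card A + (card A choose 2)"
    using assms by (simp add: n_subsets)
  finally have "card {s. s \<subseteq> A \<and> card s \<le> 2} = 1 + card A + (card A choose 2)" .
  moreover have "2 * (card A choose 2) + card A = card A * card A"
    by (simp add: choose_two algebra_simps diff_mult_distrib2)
  then have "2 * int (card A choose 2) + int (card A) = int (card A) * int (card A)"
    by (metis (mono_tags) of_nat_add of_nat_mult of_nat_numeral)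
  ultimately show ?thesis
    by (simp add: power2_eq_square)
qed

text \<open>Edges come in pairs \<open>s\<close>, \<open>insert 0 s\<close> with \<open>s\<close> in
  \<open>S\<close>. Both members occur because 0 is a vertex for positive \<open>n\<close>.\<close>

lemma card_star:
  assumes "0 < n"
  shows "int (card (edges (star_complex n))) = (int n)\<^sup>2 - int n + 2"
proof -
  define S where "S = {s. s \<subseteq> {1..<n} \<and> card s \<le> 2}"
  have V: "{..<n} = insert 0 {1..<n}" using assms by auto
  have fin: "finite S" by (simp add: S_def)
  have zero: "0 \<notin> s" if "s \<in> S" for s using that by (auto simp: S_def)
  have face: "e \<in> edges (star_complex n) \<longleftrightarrow> e - {0} \<in> S" for e
    by (auto simp: star_complex_def edges_def V S_def)
  have "edges (star_complex n) = S \<union> insert 0 ` S"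
  proof (intro equalityI subsetI)
    fix e assume "e \<in> edges (star_complex n)"
    then have e: "e - {0} \<in> S" by (simp add: face)
    show "e \<in> S \<union> insert 0 ` S"
    proof (cases "0 \<in> e")
      case True
      then have "e = insert 0 (e - {0})" by blast
      with e have "e \<in> insert 0 ` S" by (rule rev_image_eqI)
      then show ?thesis ..
    next
      case False
      with e show ?thesis by simp
    qed
  next
    fix e assume "e \<in> S \<union> insert 0 ` S"
    then show "e \<in> edges (star_complex n)"
      using zero by (auto simp: face)
  qed
  moreover have "S \<inter> insert 0 ` S = {}" using zero by auto
  ultimately have "card (edges (star_complex n)) = card S + card (insert 0 ` S)"
    using fin by (simp add: card_Un_disjoint)
  also have "card (insert 0 ` S) = card S"
    by (intro card_image inj_onI) (metis zero insert_ident)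
  finally have "int (card (edges (star_complex n))) = 2 * int (card S)" by simp
  also have "\<dots> = (int n - 1)\<^sup>2 + (int n - 1) + 2"
    using card_subsets_le_two[of "{1..<n}"] assms by (simp add: S_def of_nat_diff)
  finally show ?thesis by (simp add: power2_eq_square algebra_simps)
qed

section \<open>Bounds for the extremal number\<close>

theorem theorem1p4:
  shows "\<exists>C::nat. \<forall>n::nat. n > 0 \<longrightarrow>
           (int n)^2 - int n + 2 \<le> int (ex_num n F_cplx) \<and>
           int (ex_num n F_cplx) \<le> (int n)^2 - int n + int C"
proof (intro exI[of _ "2 ^ 25"] allI impI)
  fix n :: nat
  assume n: "n > 0"
  define S where "S = {card (edges H) | H :: nat cplx.
      simplicial_complex H \<and> finite (vertices H) \<and> card (vertices H) = n \<and>
      \<not> contains_copy H F_cplx}"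
  have ex: "ex_num n F_cplx = Max S" by (simp add: ex_num_def S_def)
  have upper: "int k \<le> (int n)\<^sup>2 - int n + 2 ^ 25" if k: "k \<in> S" for k
  proof -
    obtain H :: "nat cplx" where H: "k = card (edges H)" "simplicial_complex H"
      "finite (vertices H)" "card (vertices H) = n" "\<not> contains_copy H F_cplx"
      using k unfolding S_def by blast
    then show ?thesis
      using card_joined_triple_free_le[of "vertices H" "edges H"] joined_triple_free_if_no_copy[of H]
      unfolding simplicial_complex_def by blast
  qed
  have "vertices (star_complex n) = {..<n}" by (simp add: star_complex_def vertices_def)
  then have star: "card (edges (star_complex n)) \<in> S"
    unfolding S_def using simplicial_complex_star star_no_copy
    by (intro CollectI exI[of _ "star_complex n"]) simp
  \<comment> \<open>\<open>Max\<close> is meaningful only on a finite nonempty set: the upper bound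
    gives finiteness, the star complex a member.\<close>
  have "S \<subseteq> {..nat ((int n)\<^sup>2 - int n + 2 ^ 25)}"
    using upper by fastforce
  then have fin: "finite S" by (rule finite_subset) simp
  have "card (edges (star_complex n)) \<le> Max S" using fin star by (rule Max_ge)
  moreover have "Max S \<in> S" using fin star by (intro Max_in) auto
  ultimately show "(int n)^2 - int n + 2 \<le> int (ex_num n F_cplx) \<and>
      int (ex_num n F_cplx) \<le> (int n)^2 - int n + int (2 ^ 25)"
    using card_star[OF n] upper[of "Max S"] ex by auto
qed

end
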